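(* Let $n\geq 2$ be an integer and let $S$ be a sequence in $\mathbb Z_n$. Then $S$ is a $D$-extremal sequence for $(\mathbb Z_n',\{1\})$ if and only if $S$ is a translate of a sequence which is equivalent to the sequence $(0,1)$.
   Context: $\mathbb Z_n=\mathbb Z/n\mathbb Z$ as a module over itself and $\mathbb Z_n'=\mathbb Z_n\setminus\{0\}$. A subsequence is a non-empty subfamily of terms in the original order. For non-empty $A,B\subseteq\mathbb Z_n$, a sequence $(x_1,\ldots,x_k)$ is an $(A,B)$-weighted zero-sum sequence if there exist $a_i\in A$, $b_i\in B$ with $\sum a_ix_i=0$ and $\sum b_ia_i=0$. $D_{A,B}(n)$ is the least positive $k$ such that every sequence of length $k$ in $\mathbb Z_n$ has an $(A,B)$-weighted zero-sum subsequence; a $D$-extremal sequence for $(A,B)$ is a sequence of length $D_{A,B}(n)-1$ having no $(A,B)$-weighted zero-sum subsequence. A translate of $(x_1,\ldots,x_k)$ is $(x_1+x,\ldots,x_k+x)$ for some $x\in\mathbb Z_n$. Sequences $(x_1,\ldots,x_k)$ and $(y_1,\ldots,y_k)$ are equivalent if there exist a permutation $\sigma$ of $[1,k]$ and a unit $u\in\mathbb Z_n$ with $y_{\sigma(i)}=ux_i$ for all $i$. *)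

theory Defs
  imports
    "HOL-Number_Theory.Residues"
    "HOL-Combinatorics.Permutations"
    "HOL-Library.Sublist"
begin

text \<open>
  The ring of integers modulo \<open>n\<close> has carrier \<open>{0..n - 1}\<close>. Sequences in it are lists
  \<open>S \<in> lists (carrier (Zmod n))\<close>, indexed from 0.
\<close>

abbreviation Zmod :: "nat \<Rightarrow> int ring" where
  "Zmod n \<equiv> residue_ring (int n)"

definition Zmod_nonzero :: "nat \<Rightarrow> int set" where
  "Zmod_nonzero n = carrier (Zmod n) - {\<zero>\<^bsub>Zmod n\<^esub>}"

definition weighted_zero_sum :: "nat \<Rightarrow> int set \<Rightarrow> int set \<Rightarrow> int list \<Rightarrow> bool" where
  "weighted_zero_sum n A B xs \<longleftrightarrow>
     (\<exists>a b. (\<forall>i < length xs. a i \<in> A \<and> b i \<in> B) \<and>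
        (\<Oplus>\<^bsub>Zmod n\<^esub>i\<in>{..<length xs}. a i \<otimes>\<^bsub>Zmod n\<^esub> xs ! i) = \<zero>\<^bsub>Zmod n\<^esub> \<and>
        (\<Oplus>\<^bsub>Zmod n\<^esub>i\<in>{..<length xs}. b i \<otimes>\<^bsub>Zmod n\<^esub> a i) = \<zero>\<^bsub>Zmod n\<^esub>)"

definition has_weighted_zero_sum_subseq :: "nat \<Rightarrow> int set \<Rightarrow> int set \<Rightarrow> int list \<Rightarrow> bool" where
  "has_weighted_zero_sum_subseq n A B S \<longleftrightarrow>
     (\<exists>T. T \<noteq> [] \<and> subseq T S \<and> weighted_zero_sum n A B T)"

text \<open>
  For \<open>n \<ge> 1\<close> and non-empty subsets \<open>A\<close>, \<open>B\<close> of the carrier the minimum below exists: a sequence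
  with more than \<open>n * (n - 1)\<close> terms has \<open>n\<close> equal terms, and these, with constant weights, form a
  weighted zero-sum subsequence.
\<close>

definition davenport :: "nat \<Rightarrow> int set \<Rightarrow> int set \<Rightarrow> nat" where
  "davenport n A B =
     (LEAST k. 0 < k \<and> (\<forall>S \<in> lists (carrier (Zmod n)).
        length S = k \<longrightarrow> has_weighted_zero_sum_subseq n A B S))"

definition D_extremal :: "nat \<Rightarrow> int set \<Rightarrow> int set \<Rightarrow> int list \<Rightarrow> bool" where
  "D_extremal n A B S \<longleftrightarrow>
     S \<in> lists (carrier (Zmod n)) \<and> length S = davenport n A B - 1 \<and>
     \<not> has_weighted_zero_sum_subseq n A B S"

definition is_translate_of :: "nat \<Rightarrow> int list \<Rightarrow> int list \<Rightarrow> bool" where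
  "is_translate_of n ys xs \<longleftrightarrow>
     (\<exists>x \<in> carrier (Zmod n). ys = map (\<lambda>y. y \<oplus>\<^bsub>Zmod n\<^esub> x) xs)"

definition equivalent_seq :: "nat \<Rightarrow> int list \<Rightarrow> int list \<Rightarrow> bool" where
  "equivalent_seq n xs ys \<longleftrightarrow>
     length xs = length ys \<and>
     (\<exists>\<sigma> u. \<sigma> permutes {..<length xs} \<and> u \<in> Units (Zmod n) \<and>
        (\<forall>i < length xs. ys ! \<sigma> i = u \<otimes>\<^bsub>Zmod n\<^esub> xs ! i))"

end

theory Submission
  imports Defs
begin

text \<open>
  Two terms \<open>x, y\<close> admit weights \<open>a, - a\<close> exactly when \<open>a (x - y) = 0\<close> for some \<open>a \<noteq> 0\<close>, that is,
  when \<open>x - y\<close> is not a unit. Three pairwise distinct terms \<open>x, y, z\<close> always admit the weights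
  \<open>y - z, z - x, x - y\<close>. Hence the constant is 3 and the extremal sequences are the pairs whose
  difference is a unit.
\<close>

lemma (in residues) finsum_mod_eq:
  "finite I \<Longrightarrow> (\<Oplus>i\<in>I. f i mod m) = (\<Sum>i\<in>I. f i) mod m"
proof (induction rule: finite_induct)
  case empty
  then show ?case by (simp add: res_zero_eq)
next
  case (insert i I)
  then show ?case by (simp add: res_add_eq mod_add_eq)
qed

text \<open>Moves from the residue ring to the integers. Since each weight in \<open>B\<close> must
  be 1, the second condition only says that the \<open>a i\<close> sum to zero. Integer weights need
  no reduction to the range from 1 to \<open>n - 1\<close>, so later witnesses may be plain
  differences or negatives.\<close>

lemma weighted_zero_sum_nonzero_one_iff:
  assumes "n \<ge> 2"
  shows "weighted_zero_sum n (Zmod_nonzero n) {\<one>\<^bsub>Zmod n\<^esub>} xs \<longleftrightarrow>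
    (\<exists>a. (\<forall>i < length xs. \<not> int n dvd a i) \<and>
      int n dvd (\<Sum>i<length xs. a i * xs ! i) \<and> int n dvd (\<Sum>i<length xs. a i))"
    (is "?W \<longleftrightarrow> (\<exists>a. ?P a)")
proof -
  interpret residues "int n" "Zmod n"
    using assms by unfold_locales auto
  have sum_mult: "(\<Oplus>\<^bsub>Zmod n\<^esub>i\<in>{..<length xs}. a i \<otimes>\<^bsub>Zmod n\<^esub> xs ! i)
      = (\<Sum>i<length xs. a i * xs ! i) mod int n" for a
    unfolding res_mult_eq by (rule finsum_mod_eq) simp
  have sum_one: "(\<Oplus>\<^bsub>Zmod n\<^esub>i\<in>{..<length xs}. b i \<otimes>\<^bsub>Zmod n\<^esub> a i)
      = (\<Sum>i<length xs. a i) mod int n"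
    if "\<forall>i < length xs. b i = 1" for a b
  proof -
    have "(\<Sum>i<length xs. b i * a i) = (\<Sum>i<length xs. a i)"
      using that by (intro sum.cong) auto
    then show ?thesis
      unfolding res_mult_eq by (simp add: finsum_mod_eq)
  qed
  have nonzero: "a \<in> Zmod_nonzero n \<longleftrightarrow> 0 < a \<and> a < int n" for a
    by (auto simp: Zmod_nonzero_def res_carrier_eq res_zero_eq)
  show ?thesis
  proof
    assume ?W
    then obtain a b where ab: "\<forall>i < length xs. 0 < a i \<and> a i < int n \<and> b i = 1"
      and "(\<Oplus>\<^bsub>Zmod n\<^esub>i\<in>{..<length xs}. a i \<otimes>\<^bsub>Zmod n\<^esub> xs ! i) = 0"
      and "(\<Oplus>\<^bsub>Zmod n\<^esub>i\<in>{..<length xs}. b i \<otimes>\<^bsub>Zmod n\<^esub> a i) = 0"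
      unfolding weighted_zero_sum_def nonzero by (auto simp: res_one_eq res_zero_eq)
    then have "?P a"
      using sum_mult[of a] sum_one[of b a] by (auto simp: dvd_eq_mod_eq_0 zdvd_not_zless)
    then show "\<exists>a. ?P a" by blast
  next
    assume "\<exists>a. ?P a"
    then obtain a where a: "?P a" by blast
    \<comment> \<open>Reducing the weights puts them in the carrier and changes neither sum modulo
      \<open>n\<close>; a weight not divisible by \<open>n\<close> keeps a nonzero residue.\<close>
    define c where "c i = a i mod int n" for i
    have "c i \<in> Zmod_nonzero n" if "i < length xs" for i
    proof -
      have "a i mod int n \<noteq> 0"
        using a that by (simp add: dvd_eq_mod_eq_0)
      then show ?thesis
        using pos_mod_sign[of "int n" "a i"] pos_mod_bound[of "int n" "a i"] m_gt_one
        unfolding nonzero c_def by linarith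
    qed
    moreover have "(\<Sum>i<length xs. c i * xs ! i) mod int n = (\<Sum>i<length xs. a i * xs ! i) mod int n"
      unfolding c_def cong_def[symmetric] by (rule cong_sum) (simp add: cong_def mod_mult_left_eq)
    moreover have "(\<Sum>i<length xs. c i) mod int n = (\<Sum>i<length xs. a i) mod int n"
      unfolding c_def by (rule mod_sum_eq)
    ultimately show ?W
      unfolding weighted_zero_sum_def using a sum_mult[of c] sum_one[of "\<lambda>_. 1" c]
      by (intro exI[of _ c] exI[of _ "\<lambda>_. 1"]) (auto simp: res_one_eq res_zero_eq)
  qed
qed

text \<open>The weights sum to zero, so a single weight would itself be zero modulo
  \<open>n\<close>.\<close>

lemma weighted_zero_sum_singleton:
  assumes "n \<ge> 2"
  shows "\<not> weighted_zero_sum n (Zmod_nonzero n) {\<one>\<^bsub>Zmod n\<^esub>} [x]"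
  using weighted_zero_sum_nonzero_one_iff[OF assms] by auto

lemma weighted_zero_sum_pair:
  assumes "n \<ge> 2"
  shows "weighted_zero_sum n (Zmod_nonzero n) {\<one>\<^bsub>Zmod n\<^esub>} [x, y] \<longleftrightarrow> \<not> coprime (x - y) (int n)"
proof
  assume "weighted_zero_sum n (Zmod_nonzero n) {\<one>\<^bsub>Zmod n\<^esub>} [x, y]"
  then obtain a :: "nat \<Rightarrow> int" where a: "\<not> int n dvd a 0"
    and "int n dvd a 0 * x + a 1 * y" "int n dvd a 0 + a 1"
    using weighted_zero_sum_nonzero_one_iff[OF assms]
    by (auto simp: lessThan_Suc add.commute)
  \<comment> \<open>Subtracting \<open>y\<close> times the sum of the weights eliminates
    \<open>a 1\<close>. If \<open>x - y\<close> were coprime to \<open>n\<close>, it could be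
    cancelled and \<open>n\<close> would divide \<open>a 0\<close>.\<close>
  then have "int n dvd (a 0 * x + a 1 * y) - y * (a 0 + a 1)"
    by (metis dvd_diff dvd_mult)
  then have "int n dvd a 0 * (x - y)"
    by (simp add: algebra_simps)
  with a show "\<not> coprime (x - y) (int n)"
    by (metis coprime_commute coprime_dvd_mult_left_iff)
next
  assume ncop: "\<not> coprime (x - y) (int n)"
  \<comment> \<open>The weight will be \<open>k = n / g\<close>: it kills \<open>x - y\<close>
    modulo \<open>n\<close>, and it is nonzero modulo \<open>n\<close> because \<open>g > 1\<close>.
    For \<open>x = y\<close> this gives \<open>g = n\<close> and \<open>k = 1\<close>.\<close>
  define g where "g = gcd (x - y) (int n)"
  obtain k where k: "int n = g * k"
    unfolding g_def by (meson dvdE gcd_dvd2)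
  obtain l where l: "x - y = g * l"
    unfolding g_def by (meson dvdE gcd_dvd1)
  have "g \<ge> 0" "g \<noteq> 1"
    using ncop by (simp_all add: g_def coprime_iff_gcd_eq_1)
  moreover have "g * k > 0"
    using k assms by linarith
  ultimately have "g > 1" "k > 0"
    by (auto simp: zero_less_mult_iff)
  then have ndvd: "\<not> int n dvd k"
    unfolding k by (auto dest: zdvd_imp_le)
  have "k * x - k * y = int n * l"
    using k l by (metis mult.assoc mult.commute right_diff_distrib)
  then show "weighted_zero_sum n (Zmod_nonzero n) {\<one>\<^bsub>Zmod n\<^esub>} [x, y]"
    unfolding weighted_zero_sum_nonzero_one_iff[OF assms] using ndvd
    by (intro exI[of _ "\<lambda>i. if i = 0 then k else - k"])
      (auto simp: lessThan_Suc less_Suc_eq)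
qed

text \<open>The weights form the cross product of \<open>(x, y, z)\<close> with
  \<open>(1, 1, 1)\<close>, so they are orthogonal to both vectors already over the integers.
  Pairwise incongruence makes each weight nonzero modulo \<open>n\<close>.\<close>

lemma weighted_zero_sum_triple:
  assumes "n \<ge> 2" "\<not> int n dvd x - y" "\<not> int n dvd x - z" "\<not> int n dvd y - z"
  shows "weighted_zero_sum n (Zmod_nonzero n) {\<one>\<^bsub>Zmod n\<^esub>} [x, y, z]"
proof -
  define a where "a = (\<lambda>i::nat. [y - z, z - x, x - y] ! i)"
  have "\<not> int n dvd z - x"
    using assms(3) by (simp add: dvd_diff_commute)
  with assms show ?thesis
    unfolding weighted_zero_sum_nonzero_one_iff[OF assms(1)]
    by (intro exI[of _ a]) (auto simp: a_def lessThan_Suc less_Suc_eq algebra_simps)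
qed

lemma has_weighted_zero_sum_subseq_pair:
  assumes "n \<ge> 2"
  shows "has_weighted_zero_sum_subseq n (Zmod_nonzero n) {\<one>\<^bsub>Zmod n\<^esub>} [x, y]
    \<longleftrightarrow> \<not> coprime (x - y) (int n)"
proof
  assume "has_weighted_zero_sum_subseq n (Zmod_nonzero n) {\<one>\<^bsub>Zmod n\<^esub>} [x, y]"
  then obtain T where "T \<noteq> []" "subseq T [x, y]"
    and T: "weighted_zero_sum n (Zmod_nonzero n) {\<one>\<^bsub>Zmod n\<^esub>} T"
    unfolding has_weighted_zero_sum_subseq_def by blast
  then have "T = [x] \<or> T = [y] \<or> T = [x, y]"
    by (auto elim!: list_emb.cases)
  with T show "\<not> coprime (x - y) (int n)"
    using weighted_zero_sum_singleton[OF assms] weighted_zero_sum_pair[OF assms] by blast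
next
  assume "\<not> coprime (x - y) (int n)"
  then show "has_weighted_zero_sum_subseq n (Zmod_nonzero n) {\<one>\<^bsub>Zmod n\<^esub>} [x, y]"
    unfolding has_weighted_zero_sum_subseq_def using weighted_zero_sum_pair[OF assms]
    by (intro exI[of _ "[x, y]"]) auto
qed

text \<open>If two terms are congruent, their difference has gcd \<open>n > 1\<close> with
  \<open>n\<close> and the pair criterion applies; otherwise the whole triple works.\<close>

lemma has_weighted_zero_sum_subseq_triple:
  assumes "n \<ge> 2"
  shows "has_weighted_zero_sum_subseq n (Zmod_nonzero n) {\<one>\<^bsub>Zmod n\<^esub>} [x, y, z]"
proof -
  have pair: "weighted_zero_sum n (Zmod_nonzero n) {\<one>\<^bsub>Zmod n\<^esub>} [u, v]" if "int n dvd u - v" for u v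
  proof -
    have "gcd (u - v) (int n) = int n"
      using that by (simp add: gcd_proj2_iff)
    then show ?thesis
      using assms by (simp add: weighted_zero_sum_pair coprime_iff_gcd_eq_1)
  qed
  have "subseq [x, y] [x, y, z]" "subseq [x, z] [x, y, z]" "subseq [y, z] [x, y, z]"
    by simp_all
  then show ?thesis
    unfolding has_weighted_zero_sum_subseq_def
    using pair weighted_zero_sum_triple[OF assms]
    by (metis list.distinct(1) subseq_order.order_refl)
qed

lemma davenport_nonzero_one:
  assumes "n \<ge> 2"
  shows "davenport n (Zmod_nonzero n) {\<one>\<^bsub>Zmod n\<^esub>} = 3"
  unfolding davenport_def
proof (rule Least_equality)
  show "0 < (3::nat) \<and> (\<forall>S \<in> lists (carrier (Zmod n)). length S = 3 \<longrightarrow>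
      has_weighted_zero_sum_subseq n (Zmod_nonzero n) {\<one>\<^bsub>Zmod n\<^esub>} S)"
    using has_weighted_zero_sum_subseq_triple[OF assms]
    by (auto simp: numeral_3_eq_3 length_Suc_conv)
next
  interpret residues "int n" "Zmod n"
    using assms by unfold_locales auto
  fix k
  assume k: "0 < k \<and> (\<forall>S \<in> lists (carrier (Zmod n)). length S = k \<longrightarrow>
      has_weighted_zero_sum_subseq n (Zmod_nonzero n) {\<one>\<^bsub>Zmod n\<^esub>} S)"
  have no: "\<not> has_weighted_zero_sum_subseq n (Zmod_nonzero n) {\<one>\<^bsub>Zmod n\<^esub>} [0, 1]"
    using has_weighted_zero_sum_subseq_pair[OF assms] by simp
  show "3 \<le> k"
  \<comment> \<open>Subsequences of a prefix of \<open>[0, 1]\<close> are subsequences of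
    \<open>[0, 1]\<close>, so this one pair rules out both \<open>k = 1\<close> and
    \<open>k = 2\<close>.\<close>
  proof (rule ccontr)
    assume "\<not> 3 \<le> k"
    with k have "length (take k [0, 1 :: int]) = k" by auto
    moreover have "take k [0, 1] \<in> lists (carrier (Zmod n))"
      using assms by (auto simp: res_carrier_eq dest!: in_set_takeD)
    ultimately have "has_weighted_zero_sum_subseq n (Zmod_nonzero n) {\<one>\<^bsub>Zmod n\<^esub>} (take k [0, 1])"
      using k by blast
    moreover have "subseq (take k [0, 1]) [0, 1 :: int]"
      by (rule prefix_imp_subseq[OF take_is_prefix])
    ultimately show False
      using no unfolding has_weighted_zero_sum_subseq_def
      by (meson subseq_order.order_trans)
  qed
qed

lemma D_extremal_nonzero_one_iff:
  assumes "n \<ge> 2" "S \<in> lists (carrier (Zmod n))"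
  shows "D_extremal n (Zmod_nonzero n) {\<one>\<^bsub>Zmod n\<^esub>} S \<longleftrightarrow>
    (\<exists>x y. S = [x, y] \<and> coprime (x - y) (int n))"
proof -
  have "length S = 2 \<longleftrightarrow> (\<exists>x y. S = [x, y])"
    by (auto simp: numeral_2_eq_2 length_Suc_conv)
  with assms show ?thesis
    unfolding D_extremal_def davenport_nonzero_one[OF assms(1)]
    using has_weighted_zero_sum_subseq_pair by auto
qed

text \<open>For pairs, the difference of the two terms is a translation invariant modulo
  \<open>n\<close>; a swap changes its sign and scaling by a unit multiplies it by that unit. All of
  these preserve coprimality to \<open>n\<close>, and \<open>(0, 1)\<close> has difference
  -1.\<close>

lemma translate_equivalent_zero_one_iff:
  assumes "n \<ge> 2" "S \<in> lists (carrier (Zmod n))"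
  shows "(\<exists>T \<in> lists (carrier (Zmod n)).
       equivalent_seq n T [\<zero>\<^bsub>Zmod n\<^esub>, \<one>\<^bsub>Zmod n\<^esub>] \<and> is_translate_of n S T) \<longleftrightarrow>
    (\<exists>x y. S = [x, y] \<and> coprime (x - y) (int n))"
proof -
  interpret residues "int n" "Zmod n"
    using assms by unfold_locales auto
  show ?thesis
  proof
    assume "\<exists>T \<in> lists (carrier (Zmod n)).
       equivalent_seq n T [\<zero>\<^bsub>Zmod n\<^esub>, \<one>\<^bsub>Zmod n\<^esub>] \<and> is_translate_of n S T"
    then obtain T where eq: "equivalent_seq n T [\<zero>\<^bsub>Zmod n\<^esub>, \<one>\<^bsub>Zmod n\<^esub>]" and "is_translate_of n S T"
      by blast
    then obtain t where S: "S = map (\<lambda>y. (y + t) mod int n) T"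
      by (auto simp: is_translate_of_def res_add_eq)
    have len: "length T = 2"
      using eq by (simp add: equivalent_seq_def)
    with eq obtain \<sigma> u where \<sigma>: "\<sigma> permutes {..<2}"
      and u: "\<forall>i < 2. [0, 1] ! \<sigma> i = (u * T ! i) mod int n"
      by (auto simp: equivalent_seq_def res_zero_eq res_one_eq res_mult_eq)
    obtain p q where T: "T = [p, q]"
      using len by (auto simp: numeral_2_eq_2 length_Suc_conv)
    have "\<sigma> 0 < 2" "\<sigma> 1 < 2" "\<sigma> 0 \<noteq> \<sigma> 1"
      using \<sigma> permutes_in_image[OF \<sigma>] permutes_inj[OF \<sigma>] by (auto dest: injD)
    \<comment> \<open>Whether \<open>\<sigma>\<close> is the identity or the swap matters only for
      the sign.\<close>
    then have "[0, 1 :: int] ! \<sigma> 0 - [0, 1] ! \<sigma> 1 = 1 \<or> [0, 1 :: int] ! \<sigma> 0 - [0, 1] ! \<sigma> 1 = - 1"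
      by (auto simp: less_2_cases_iff)
    then have "(u * p) mod int n - (u * q) mod int n = 1 \<or> (u * p) mod int n - (u * q) mod int n = - 1"
      using u by (simp add: T)
    moreover have "[(u * p) mod int n - (u * q) mod int n = u * (p - q)] (mod int n)"
      unfolding cong_def by (simp add: mod_diff_eq right_diff_distrib)
    ultimately have "coprime (u * (p - q)) (int n)"
      by (metis cong_imp_coprime coprime_1_left coprime_minus_left_iff)
    then have "coprime (p - q) (int n)"
      by simp
    \<comment> \<open>The shift \<open>t\<close> cancels, which carries coprimality from
      \<open>T\<close> over to \<open>S\<close>.\<close>
    moreover have "[(p + t) mod int n - (q + t) mod int n = p - q] (mod int n)"
      unfolding cong_def by (simp add: mod_diff_eq)
    ultimately have "coprime ((p + t) mod int n - (q + t) mod int n) (int n)"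
      by (metis cong_imp_coprime cong_sym)
    then show "\<exists>x y. S = [x, y] \<and> coprime (x - y) (int n)"
      by (simp add: S T)
  next
    assume "\<exists>x y. S = [x, y] \<and> coprime (x - y) (int n)"
    then obtain x y where S: "S = [x, y]" and "coprime (x - y) (int n)" by blast
    then have cop: "coprime (y - x) (int n)"
      by (metis coprime_minus_left_iff minus_diff_eq)
    have xy: "0 \<le> x" "x < int n" "0 \<le> y" "y < int n"
      using assms(2) by (auto simp: S res_carrier_eq)
    \<comment> \<open>The scaling unit is the inverse of \<open>y - x\<close> modulo
      \<open>n\<close>, reduced below to lie in the carrier.\<close>
    obtain v where v: "[(y - x) * v = 1] (mod int n)"
      using cop cong_solve_coprime_int by blast
    define u where "u = v mod int n"
    have uv: "u * ((y - x) mod int n) mod int n = 1"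
      using v assms(1) unfolding cong_def u_def by (simp add: mod_mult_eq mult.commute)
    then have "coprime u (int n)"
      by (metis coprime_1_left coprime_mod_left_iff coprime_mult_left_iff m_gt_one
          not_one_less_zero less_irrefl)
    moreover have "u \<ge> 0" "u < int n" "u \<noteq> 0"
      using assms(1) uv by (auto simp: u_def)
    ultimately have "u \<in> Units (Zmod n)"
      by (simp add: res_units_eq)
    \<comment> \<open>\<open>T\<close> is \<open>S\<close> shifted by \<open>- x\<close>. Its first
      term is already 0 and \<open>u\<close> sends the second to 1, so the identity permutation
      suffices.\<close>
    moreover define T where "T = [0, (y - x) mod int n]"
    ultimately have "equivalent_seq n T [\<zero>\<^bsub>Zmod n\<^esub>, \<one>\<^bsub>Zmod n\<^esub>]"
      unfolding equivalent_seq_def using uv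
      by (intro conjI exI[of _ id] exI[of _ u])
        (auto simp: permutes_id res_zero_eq res_one_eq res_mult_eq less_Suc_eq)
    \<comment> \<open>Shifting back by \<open>x\<close> returns \<open>x\<close> and
      \<open>y\<close> themselves, not just congruent integers, because both are reduced.\<close>
    moreover have "is_translate_of n S T"
      unfolding is_translate_of_def using xy
      by (intro bexI[of _ x])
        (auto simp: S T_def res_add_eq res_carrier_eq mod_simps)
    moreover have "T \<in> lists (carrier (Zmod n))"
      using assms(1) by (auto simp: T_def res_carrier_eq)
    ultimately show "\<exists>T \<in> lists (carrier (Zmod n)).
       equivalent_seq n T [\<zero>\<^bsub>Zmod n\<^esub>, \<one>\<^bsub>Zmod n\<^esub>] \<and> is_translate_of n S T"
      by blast
  qed
qed

theorem theorem9:
  fixes n :: nat and S :: "int list"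
  assumes "n \<ge> 2"
    and "S \<in> lists (carrier (Zmod n))"
  shows "D_extremal n (Zmod_nonzero n) {\<one>\<^bsub>Zmod n\<^esub>} S \<longleftrightarrow>
    (\<exists>T \<in> lists (carrier (Zmod n)).
       equivalent_seq n T [\<zero>\<^bsub>Zmod n\<^esub>, \<one>\<^bsub>Zmod n\<^esub>] \<and> is_translate_of n S T)"
  using D_extremal_nonzero_one_iff[OF assms] translate_equivalent_zero_one_iff[OF assms] by simp

end
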